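(* Let $\alpha>0$ and let $\psi:[0,\infty)\to[0,\infty)$ be an increasing function with $\psi(0)=0$. For $\theta\in\mathbb{R}$ let $f_\theta:\mathbb{R}\to\mathbb{R}$, $f_\theta(x)=\frac\alpha2(x-\theta)^2$, and $p_\theta=\mathsf{N}(\theta,1/\alpha)\propto e^{-f_\theta}$. Let $T\ge1$ be an integer and $\delta\in(0,1]$. Suppose there is a (randomized, possibly adaptive) algorithm $\mathtt{Alg}$ such that for every $\theta\in\{0,\delta/\sqrt\alpha\}$ and every $\psi$-oracle $O$ for $f_\theta$, $\mathtt{Alg}$ makes $T$ queries to $O$ and returns a sample whose law $\mathtt{Alg}(O)$ satisfies $D_{\mathsf{TV}}(p_\theta,\mathtt{Alg}(O))\le\frac{\delta}{10}$. Then $$T\ \ge\ \frac{1}{10\sqrt\alpha}\,F_\psi(\sqrt\alpha\,\delta),\qquad F_\psi(t):=\sup\{u\ge t:\ (1-\psi(t))\,u\ge t\,\psi(u)\}.$$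
   Context: A $\psi$-oracle for a differentiable $f:\mathbb{R}^d\to\mathbb{R}$ (here $d=1$) is a stochastic oracle $O$ which, when queried at $x$, returns a fresh independent sample $g\sim O(x)$ such that $\mathbb{E}[g]=\nabla f(x)$ and $\mathbb{E}\,\psi(\|g-\nabla f(x)\|)\le1$, for every $x$. The algorithm accesses the unknown $\theta$ only through its $T$ oracle queries (each query point may depend on previous answers and internal randomness). $D_{\mathsf{TV}}$ is total variation distance. If the set defining $F_\psi$ is empty, the supremum is read as $0$ (the bound is then vacuous). *)

theory Defs
  imports "HOL-Probability.Probability"
begin

(* A stochastic oracle is a Markov kernel: Orc x is the law of one (fresh) answer at x.
   The integrability clause is needed because the Bochner integral of a non-integrable
   function is 0. *)
definition psi_oracle ::
  "(real \<Rightarrow> real) \<Rightarrow> ('a::euclidean_space \<Rightarrow> real) \<Rightarrow> ('a \<Rightarrow> 'a measure) \<Rightarrow> bool" where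
  "psi_oracle \<psi> f Orc \<longleftrightarrow>
     Orc \<in> borel \<rightarrow>\<^sub>M prob_algebra borel \<and>
     (\<forall>x. \<exists>D. GDERIV f x :> D \<and>
        integrable (Orc x) (\<lambda>g. g) \<and> (\<integral>g. g \<partial>Orc x) = D \<and>
        (\<integral>\<^sup>+g. ennreal (\<psi> (norm (g - D))) \<partial>Orc x) \<le> 1)"

(* Internal randomness together with the first n oracle answers. *)
abbreviation history_space :: "'r measure \<Rightarrow> nat \<Rightarrow> ('r \<times> (nat \<Rightarrow> 'a::euclidean_space)) measure" where
  "history_space R n \<equiv> R \<Otimes>\<^sub>M PiM {..<n} (\<lambda>_. borel)"

(* A randomized adaptive algorithm making T queries. All internal randomness is drawn
   up front from the arbitrary probability space R; qry n (r, a) is the query point of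
   round n and out (r, a) the returned sample, where a collects the previous answers.
   Earlier query points are functions of (r, a), so they need not be recorded. *)
definition query_algorithm ::
  "'r measure \<Rightarrow> nat \<Rightarrow> (nat \<Rightarrow> 'r \<times> (nat \<Rightarrow> 'a::euclidean_space) \<Rightarrow> 'a) \<Rightarrow>
   ('r \<times> (nat \<Rightarrow> 'a) \<Rightarrow> 'a) \<Rightarrow> bool" where
  "query_algorithm R T qry out \<longleftrightarrow>
     prob_space R \<and>
     (\<forall>n<T. qry n \<in> history_space R n \<rightarrow>\<^sub>M borel) \<and>
     out \<in> history_space R T \<rightarrow>\<^sub>M borel"

(* Law of (internal randomness, first n answers) when interacting with Orc. *)
primrec transcript_law ::
  "'r measure \<Rightarrow> (nat \<Rightarrow> 'r \<times> (nat \<Rightarrow> 'a::euclidean_space) \<Rightarrow> 'a) \<Rightarrow> ('a \<Rightarrow> 'a measure) \<Rightarrow>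
   nat \<Rightarrow> ('r \<times> (nat \<Rightarrow> 'a)) measure" where
  "transcript_law R qry Orc 0 = distr R (history_space R 0) (\<lambda>r. (r, \<lambda>_. undefined))"
| "transcript_law R qry Orc (Suc n) =
     transcript_law R qry Orc n \<bind>
       (\<lambda>(r, a). distr (Orc (qry n (r, a))) (history_space R (Suc n)) (\<lambda>g. (r, a(n := g))))"

definition output_law ::
  "'r measure \<Rightarrow> nat \<Rightarrow> (nat \<Rightarrow> 'r \<times> (nat \<Rightarrow> 'a::euclidean_space) \<Rightarrow> 'a) \<Rightarrow>
   ('r \<times> (nat \<Rightarrow> 'a) \<Rightarrow> 'a) \<Rightarrow> ('a \<Rightarrow> 'a measure) \<Rightarrow> 'a measure" where
  "output_law R T qry out Orc = distr (transcript_law R qry Orc T) borel out"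

(* Total variation distance; intended for probability measures on a common sigma-algebra. *)
definition tv_dist :: "'a measure \<Rightarrow> 'a measure \<Rightarrow> real" where
  "tv_dist M N = (SUP A\<in>sets M. \<bar>measure M A - measure N A\<bar>)"

definition f_quad :: "real \<Rightarrow> real \<Rightarrow> real \<Rightarrow> real" where
  "f_quad \<alpha> \<theta> x = \<alpha> / 2 * (x - \<theta>)\<^sup>2"

(* normal_density takes the standard deviation, so this is N(\<theta>, 1/\<alpha>) with variance 1/\<alpha>. *)
definition p_gauss :: "real \<Rightarrow> real \<Rightarrow> real measure" where
  "p_gauss \<alpha> \<theta> = density lborel (\<lambda>x. ennreal (normal_density \<theta> (1 / sqrt \<alpha>) x))"

(* The supremum may be infinite; over the empty set it is read as 0 (in ereal it would be
   minus infinity). *)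
definition F_psi :: "(real \<Rightarrow> real) \<Rightarrow> real \<Rightarrow> ereal" where
  "F_psi \<psi> t =
     (let S = {u. u \<ge> t \<and> (1 - \<psi> t) * u \<ge> t * \<psi> u}
      in if S = {} then 0 else (SUP u\<in>S. ereal u))"

end

theory Submission
  imports Defs
begin

text \<open>Under both hypotheses let the oracle answer \<open>\<alpha> x\<close>, except that under \<open>\<theta> = \<delta> / sqrt \<alpha>\<close> it
  answers, with probability \<open>p = t / (u + t)\<close> where \<open>t = sqrt \<alpha> \<delta>\<close>, with a large jump of size
  \<open>u + t\<close> that corrects the mean by \<open>t\<close>. Unless a jump occurs during the \<open>T\<close> queries the two cases are
  indistinguishable, so the output laws differ by at most \<open>T p\<close> on every event. The two Gaussians
  differ by at least \<open>3 \<delta> / 10\<close> on a half line, which forces \<open>T p \<ge> \<delta> / 10\<close>.\<close>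

subsection \<open>Comparing transcripts\<close>

text \<open>One round has to be a Markov kernel from histories of length \<open>n\<close> to
  histories of length \<open>Suc n\<close> before the bind in \<open>transcript_law\<close> obeys
  the usual integration rules. It is the oracle kernel pushed forward along the update map, which is
  jointly measurable in history and answer.\<close>

lemma measurable_answer_step:
  fixes qry :: "'r \<times> (nat \<Rightarrow> 'a::euclidean_space) \<Rightarrow> 'a"
  assumes Orc: "Orc \<in> borel \<rightarrow>\<^sub>M prob_algebra borel"
    and q: "qry \<in> history_space R n \<rightarrow>\<^sub>M borel"
  shows "(\<lambda>(r, a). distr (Orc (qry (r, a))) (history_space R (Suc n)) (\<lambda>g. (r, a(n := g))))
    \<in> history_space R n \<rightarrow>\<^sub>M prob_algebra (history_space R (Suc n))"
proof -
  have upd: "(\<lambda>(h, g). (fst h, (snd h)(n := g)))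
      \<in> history_space R n \<Otimes>\<^sub>M borel \<rightarrow>\<^sub>M history_space R (Suc n)"
    unfolding lessThan_Suc case_prod_beta
    by (intro measurable_Pair measurable_fun_upd[where J="{..<n}"]
          measurable_compose[OF measurable_fst] measurable_fst measurable_snd) auto
  have K: "(\<lambda>h. Orc (qry h)) \<in> history_space R n \<rightarrow>\<^sub>M prob_algebra borel"
    using q Orc by (rule measurable_compose)
  have "(\<lambda>h. distr (Orc (qry h)) (history_space R (Suc n)) (\<lambda>g. (fst h, (snd h)(n := g))))
    \<in> history_space R n \<rightarrow>\<^sub>M prob_algebra (history_space R (Suc n))"
    by (rule measurable_distr_prob_space2[OF K]) (use upd in simp)
  then show ?thesis
    by (simp only: case_prod_unfold prod.collapse)
qed

lemma transcript_law_in_prob_algebra: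
  fixes qry :: "nat \<Rightarrow> 'r \<times> (nat \<Rightarrow> 'a::euclidean_space) \<Rightarrow> 'a"
  assumes "prob_space R" "Orc \<in> borel \<rightarrow>\<^sub>M prob_algebra borel"
    and "\<And>k. k < n \<Longrightarrow> qry k \<in> history_space R k \<rightarrow>\<^sub>M borel"
  shows "transcript_law R qry Orc n \<in> space (prob_algebra (history_space R n))"
  using assms(3)
proof (induction n)
  case 0
  \<comment> \<open>Before any answer, \<open>\<lambda>_. undefined\<close> is the only point of the
    empty product space.\<close>
  have "(\<lambda>r. (r, \<lambda>_. undefined)) \<in> R \<rightarrow>\<^sub>M history_space R 0"
    by (auto intro!: measurable_Pair simp: PiM_empty)
  then show ?case
    using assms(1) by (auto simp: space_prob_algebra intro!: prob_space.prob_space_distr)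
next
  case (Suc n)
  then have tr: "transcript_law R qry Orc n \<in> space (prob_algebra (history_space R n))"
    by simp
  note step = measurable_answer_step[OF assms(2) Suc.prems[OF lessI]]
  show ?case
    using prob_space_bind'[OF tr step] sets_bind'[OF tr step] by (simp add: space_prob_algebra)
qed

text \<open>At every query point \<open>O2\<close> dominates \<open>c\<close> times
  \<open>O1\<close> as a measure, so each round costs one factor \<open>c\<close>. Comparing
  integrals of arbitrary nonnegative functions, not only measures of events, lets the induction
  hypothesis be applied to the inner integral over the last answer.\<close>

lemma transcript_law_mono_scale:
  fixes qry :: "nat \<Rightarrow> 'r \<times> (nat \<Rightarrow> 'a::euclidean_space) \<Rightarrow> 'a" and c :: ennreal
  assumes R: "prob_space R"
    and O1: "O1 \<in> borel \<rightarrow>\<^sub>M prob_algebra borel" and O2: "O2 \<in> borel \<rightarrow>\<^sub>M prob_algebra borel"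
    and le: "\<And>x f. f \<in> borel_measurable borel \<Longrightarrow> c * (\<integral>\<^sup>+g. f g \<partial>O1 x) \<le> (\<integral>\<^sup>+g. f g \<partial>O2 x)"
    and "\<And>k. k < n \<Longrightarrow> qry k \<in> history_space R k \<rightarrow>\<^sub>M borel"
    and "f \<in> borel_measurable (history_space R n)"
  shows "c ^ n * (\<integral>\<^sup>+h. f h \<partial>transcript_law R qry O1 n) \<le> (\<integral>\<^sup>+h. f h \<partial>transcript_law R qry O2 n)"
  using assms(5,6)
proof (induction n arbitrary: f)
  case 0
  then show ?case by simp
next
  case (Suc n)
  note f = Suc.prems(2)
  have q: "qry n \<in> history_space R n \<rightarrow>\<^sub>M borel"
    by (simp add: Suc.prems)
  define step :: "('a \<Rightarrow> 'a measure) \<Rightarrow> 'r \<times> (nat \<Rightarrow> 'a) \<Rightarrow> ('r \<times> (nat \<Rightarrow> 'a)) measure"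
    where "step Orc = (\<lambda>(r, a). distr (Orc (qry n (r, a))) (history_space R (Suc n)) (\<lambda>g. (r, a(n := g))))"
    for Orc
  have tr: "sets (transcript_law R qry Orc n) = sets (history_space R n)"
    if "Orc \<in> borel \<rightarrow>\<^sub>M prob_algebra borel" for Orc
    using transcript_law_in_prob_algebra[OF R that, of n qry] Suc.prems(1)
    by (auto simp: space_prob_algebra)
  have step: "step Orc \<in> history_space R n \<rightarrow>\<^sub>M subprob_algebra (history_space R (Suc n))"
    if "Orc \<in> borel \<rightarrow>\<^sub>M prob_algebra borel" for Orc
    unfolding step_def by (rule measurable_prob_algebraD[OF measurable_answer_step[OF that q]])
  have bind: "(\<integral>\<^sup>+h. f h \<partial>transcript_law R qry Orc (Suc n)) =
      (\<integral>\<^sup>+h. (\<integral>\<^sup>+h'. f h' \<partial>step Orc h) \<partial>transcript_law R qry Orc n)"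
    if Orc: "Orc \<in> borel \<rightarrow>\<^sub>M prob_algebra borel" for Orc
    unfolding transcript_law.simps step_def[symmetric]
    using step[OF Orc] by (intro nn_integral_bind[OF f]) (simp add: measurable_cong_sets[OF tr[OF Orc] refl])
  have step_le: "c * (\<integral>\<^sup>+h'. f h' \<partial>step O1 h) \<le> (\<integral>\<^sup>+h'. f h' \<partial>step O2 h)"
    if h: "h \<in> space (history_space R n)" for h
  proof -
    obtain r a where [simp]: "h = (r, a)" by (cases h)
    have upd: "(\<lambda>g. (r, a(n := g))) \<in> borel \<rightarrow>\<^sub>M history_space R (Suc n)"
      unfolding lessThan_Suc using h
      by (intro measurable_Pair measurable_fun_upd[where J="{..<n}"])
         (auto simp: space_pair_measure)
    have O_sets: "sets (Orc x) = sets borel" if "Orc \<in> borel \<rightarrow>\<^sub>M prob_algebra borel" for Orc and x :: 'a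
      using measurable_space[OF that, of x] by (simp add: space_prob_algebra)
    have "(\<integral>\<^sup>+h'. f h' \<partial>step Orc h) = (\<integral>\<^sup>+g. f (r, a(n := g)) \<partial>Orc (qry n h))"
      if Orc: "Orc \<in> borel \<rightarrow>\<^sub>M prob_algebra borel" for Orc
      unfolding step_def
      using upd f by (simp add: nn_integral_distr measurable_cong_sets[OF O_sets[OF Orc] refl])
    then show ?thesis
      using le[OF measurable_compose[OF upd f]] by (simp add: O1 O2)
  qed
  have meas: "(\<lambda>h. \<integral>\<^sup>+h'. f h' \<partial>step Orc h) \<in> borel_measurable (history_space R n)"
    if "Orc \<in> borel \<rightarrow>\<^sub>M prob_algebra borel" for Orc
    by (rule measurable_compose[OF step[OF that] nn_integral_measurable_subprob_algebra[OF f]])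
  \<comment> \<open>First \<open>O1\<close> is replaced by \<open>O2\<close> in the first
    \<open>n\<close> rounds, using the induction hypothesis for the mean of \<open>f\<close> after
    one further \<open>O1\<close> step; then the last answer is replaced pointwise by
    \<open>step_le\<close>.\<close>
  have "c ^ Suc n * (\<integral>\<^sup>+h. f h \<partial>transcript_law R qry O1 (Suc n))
      = c * (c ^ n * (\<integral>\<^sup>+h. (\<integral>\<^sup>+h'. f h' \<partial>step O1 h) \<partial>transcript_law R qry O1 n))"
    unfolding bind[OF O1] by (simp add: mult_ac)
  also have "\<dots> \<le> c * (\<integral>\<^sup>+h. (\<integral>\<^sup>+h'. f h' \<partial>step O1 h) \<partial>transcript_law R qry O2 n)"
    using Suc.prems(1) by (intro mult_left_mono Suc.IH meas O1) auto
  also have "\<dots> = (\<integral>\<^sup>+h. c * (\<integral>\<^sup>+h'. f h' \<partial>step O1 h) \<partial>transcript_law R qry O2 n)"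
    using meas[OF O1]
    by (intro nn_integral_cmult[symmetric]) (simp add: measurable_cong_sets[OF tr[OF O2] refl])
  also have "\<dots> \<le> (\<integral>\<^sup>+h. (\<integral>\<^sup>+h'. f h' \<partial>step O2 h) \<partial>transcript_law R qry O2 n)"
    by (intro nn_integral_mono step_le) (simp add: sets_eq_imp_space_eq[OF tr[OF O2]])
  finally show ?case
    unfolding bind[OF O2] .
qed

lemma prob_space_output_law:
  assumes "query_algorithm R T qry out" and "Orc \<in> borel \<rightarrow>\<^sub>M prob_algebra borel"
  shows "prob_space (output_law R T qry out Orc)"
proof -
  have R: "prob_space R" and q: "\<And>k. k < T \<Longrightarrow> qry k \<in> history_space R k \<rightarrow>\<^sub>M borel"
    and out: "out \<in> history_space R T \<rightarrow>\<^sub>M borel"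
    using assms(1) unfolding query_algorithm_def by blast+
  have "transcript_law R qry Orc T \<in> space (prob_algebra (history_space R T))"
    by (rule transcript_law_in_prob_algebra[OF R assms(2) q])
  then show ?thesis
    unfolding output_law_def
    using measurable_space[OF measurable_distr_prob_space[OF out]] by (simp add: space_prob_algebra)
qed

text \<open>The \<open>T\<close>-round comparison gives the factor \<open>(1 - p) ^ T\<close>, which
  Bernoulli's inequality bounds below by \<open>1 - T p\<close>. As probabilities are at most 1, the
  multiplicative loss becomes the additive loss \<open>T p\<close>.\<close>

lemma measure_output_law_le:
  fixes qry :: "nat \<Rightarrow> 'r \<times> (nat \<Rightarrow> 'a::euclidean_space) \<Rightarrow> 'a"
  assumes alg: "query_algorithm R T qry out"
    and O1: "O1 \<in> borel \<rightarrow>\<^sub>M prob_algebra borel" and O2: "O2 \<in> borel \<rightarrow>\<^sub>M prob_algebra borel"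
    and p: "0 \<le> p" "p \<le> 1"
    and le: "\<And>x f. f \<in> borel_measurable borel \<Longrightarrow>
      ennreal (1 - p) * (\<integral>\<^sup>+g. f g \<partial>O1 x) \<le> (\<integral>\<^sup>+g. f g \<partial>O2 x)"
    and A: "A \<in> sets borel"
  shows "measure (output_law R T qry out O1) A \<le> measure (output_law R T qry out O2) A + real T * p"
proof -
  have R: "prob_space R" and q: "\<And>k. k < T \<Longrightarrow> qry k \<in> history_space R k \<rightarrow>\<^sub>M borel"
    and out: "out \<in> history_space R T \<rightarrow>\<^sub>M borel"
    using alg unfolding query_algorithm_def by blast+
  interpret P1: prob_space "output_law R T qry out O1"
    by (rule prob_space_output_law[OF alg O1])
  interpret P2: prob_space "output_law R T qry out O2"
    by (rule prob_space_output_law[OF alg O2])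
  \<comment> \<open>Events of the output are written as integrals over the transcript, the form in
    which the comparison applies.\<close>
  have em: "emeasure (output_law R T qry out Orc) A =
      (\<integral>\<^sup>+h. indicator A (out h) \<partial>transcript_law R qry Orc T)"
    if "Orc \<in> borel \<rightarrow>\<^sub>M prob_algebra borel" for Orc
  proof -
    have "transcript_law R qry Orc T \<in> space (prob_algebra (history_space R T))"
      by (rule transcript_law_in_prob_algebra[OF R that q])
    then have s: "sets (transcript_law R qry Orc T) = sets (history_space R T)"
      by (simp add: space_prob_algebra)
    have "emeasure (output_law R T qry out Orc) A =
        (\<integral>\<^sup>+y. indicator A y \<partial>output_law R T qry out Orc)"
      using A by (simp add: output_law_def)
    also have "\<dots> = (\<integral>\<^sup>+h. indicator A (out h) \<partial>transcript_law R qry Orc T)"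
      unfolding output_law_def using A out
      by (intro nn_integral_distr) (simp_all add: measurable_cong_sets[OF s refl])
    finally show ?thesis .
  qed
  have "ennreal (1 - p) ^ T * emeasure (output_law R T qry out O1) A
      \<le> emeasure (output_law R T qry out O2) A"
    unfolding em[OF O1] em[OF O2]
    by (rule transcript_law_mono_scale[OF R O1 O2 le q])
       (use A out in \<open>auto intro!: measurable_compose[OF out]\<close>)
  then have "(1 - p) ^ T * measure (output_law R T qry out O1) A
      \<le> measure (output_law R T qry out O2) A"
    using p by (simp add: P1.emeasure_eq_measure P2.emeasure_eq_measure ennreal_power
        flip: ennreal_mult)
  moreover have "1 - real T * p \<le> (1 - p) ^ T"
    using Bernoulli_inequality[of "- p" T] p by simp
  then have "(1 - real T * p) * measure (output_law R T qry out O1) A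
      \<le> (1 - p) ^ T * measure (output_law R T qry out O1) A"
    by (rule mult_right_mono) simp
  moreover have "real T * p * measure (output_law R T qry out O1) A \<le> real T * p"
    using p by (intro mult_left_le) auto
  ultimately show ?thesis
    by (simp add: algebra_simps)
qed

subsection \<open>The two-point oracle\<close>

text \<open>The answer without a jump is the gradient of \<open>f_quad \<alpha> 0\<close> at
  \<open>x\<close>, whichever mean is aimed at. All these oracles share that atom, and
  \<open>p = 0\<close> gives the exact oracle for \<open>\<theta> = 0\<close>.\<close>

definition jump_oracle :: "real \<Rightarrow> real \<Rightarrow> real \<Rightarrow> real \<Rightarrow> real measure" where
  "jump_oracle \<alpha> p v x =
     distr (measure_pmf (bernoulli_pmf p)) borel (\<lambda>b. if b then \<alpha> * x - v else \<alpha> * x)"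

lemma nn_integral_jump_oracle:
  assumes "0 \<le> p" "p \<le> 1" "f \<in> borel_measurable borel"
  shows "(\<integral>\<^sup>+g. f g \<partial>jump_oracle \<alpha> p v x) =
    ennreal p * f (\<alpha> * x - v) + ennreal (1 - p) * f (\<alpha> * x)"
  unfolding jump_oracle_def using assms by (simp add: nn_integral_distr mult.commute)

lemma jump_oracle_kernel: "jump_oracle \<alpha> p v \<in> borel \<rightarrow>\<^sub>M prob_algebra borel"
proof -
  have "(\<lambda>x. distr (measure_pmf (bernoulli_pmf p)) borel (\<lambda>b. if b then \<alpha> * x - v else \<alpha> * x))
      \<in> borel \<rightarrow>\<^sub>M prob_algebra borel"
  proof (rule measurable_distr_prob_space2[where M="count_space UNIV"])
    show "(\<lambda>x. measure_pmf (bernoulli_pmf p)) \<in> borel \<rightarrow>\<^sub>M prob_algebra (count_space UNIV)"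
      by (rule measurable_const) (simp add: space_prob_algebra prob_space_measure_pmf)
  qed measurable
  then show ?thesis
    by (simp add: jump_oracle_def[abs_def])
qed

text \<open>The mean answer is \<open>\<alpha> * x - p * v\<close>, so
  \<open>p * v = \<alpha> * \<theta>\<close> makes it unbiased. The error then has size
  \<open>\<bar>v - p * v\<bar>\<close> with probability \<open>p\<close> and
  \<open>\<bar>p * v\<bar>\<close> otherwise, whatever \<open>x\<close> is; the last assumption is
  exactly the moment bound.\<close>

lemma psi_oracle_jump:
  assumes psi: "mono_on {0..} \<psi>" "\<psi> \<in> {0..} \<rightarrow> {0..}"
    and p: "0 \<le> p" "p \<le> 1" and mean: "p * v = \<alpha> * \<theta>"
    and le: "p * \<psi> \<bar>v - p * v\<bar> + (1 - p) * \<psi> \<bar>p * v\<bar> \<le> 1"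
  shows "psi_oracle \<psi> (f_quad \<alpha> \<theta>) (jump_oracle \<alpha> p v)"
  unfolding psi_oracle_def
proof (intro conjI allI)
  show "jump_oracle \<alpha> p v \<in> borel \<rightarrow>\<^sub>M prob_algebra borel"
    by (rule jump_oracle_kernel)
next
  fix x
  define D where "D = \<alpha> * (x - \<theta>)"
  have "GDERIV (f_quad \<alpha> \<theta>) x :> D"
  proof -
    have "(f_quad \<alpha> \<theta> has_real_derivative D) (at x)"
      unfolding f_quad_def[abs_def] D_def by (auto intro!: derivative_eq_intros)
    then show ?thesis
      by (simp add: gderiv_def has_field_derivative_def mult.commute)
  qed
  moreover have "integrable (jump_oracle \<alpha> p v x) (\<lambda>g. g)"
    unfolding jump_oracle_def by (subst integrable_distr_eq) (auto intro: integrable_measure_pmf_finite)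
  moreover have "(\<integral>g. g \<partial>jump_oracle \<alpha> p v x) = D"
    unfolding jump_oracle_def D_def using p mean
    by (subst integral_distr) (auto simp: algebra_simps)
  moreover have "(\<integral>\<^sup>+g. ennreal (\<psi> (norm (g - D))) \<partial>jump_oracle \<alpha> p v x) \<le> 1"
  proof -
    \<comment> \<open>Nothing is known about \<open>\<psi>\<close> at negative arguments. Extending
      it from \<open>{0..}\<close> by the constant \<open>\<psi> 0\<close> gives a globally
      monotone, hence Borel, function that agrees with \<open>\<psi>\<close> on norms.\<close>
    have "mono (\<lambda>y. \<psi> (max 0 y))"
      using psi(1) by (auto simp: mono_def mono_on_def)
    then have "(\<lambda>y. \<psi> (max 0 y)) \<in> borel_measurable borel"
      by (rule borel_measurable_mono)
    then have "(\<lambda>g. \<psi> (max 0 (norm (g - D)))) \<in> borel_measurable borel"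
      by (rule measurable_compose[rotated]) simp
    then have m: "(\<lambda>g. ennreal (\<psi> (norm (g - D)))) \<in> borel_measurable borel"
      by simp
    have *: "\<alpha> * x - v - D = - (v - p * v)" "\<alpha> * x - D = p * v"
      unfolding D_def using mean by (auto simp: algebra_simps)
    have "(\<integral>\<^sup>+g. ennreal (\<psi> (norm (g - D))) \<partial>jump_oracle \<alpha> p v x)
        = ennreal p * ennreal (\<psi> \<bar>v - p * v\<bar>) + ennreal (1 - p) * ennreal (\<psi> \<bar>p * v\<bar>)"
      unfolding nn_integral_jump_oracle[OF p m] * by (simp add: abs_minus_commute)
    also have "\<dots> = ennreal (p * \<psi> \<bar>v - p * v\<bar> + (1 - p) * \<psi> \<bar>p * v\<bar>)"
      using p psi(2) by (subst ennreal_plus) (auto simp: Pi_iff ennreal_mult')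
    also have "\<dots> \<le> 1"
      using le by simp
    finally show ?thesis .
  qed
  ultimately show "\<exists>D. GDERIV (f_quad \<alpha> \<theta>) x :> D \<and> integrable (jump_oracle \<alpha> p v x) (\<lambda>g. g) \<and>
      (\<integral>g. g \<partial>jump_oracle \<alpha> p v x) = D \<and>
      (\<integral>\<^sup>+g. ennreal (\<psi> (norm (g - D))) \<partial>jump_oracle \<alpha> p v x) \<le> 1"
    by blast
qed

subsection \<open>Total variation and Gaussians\<close>

text \<open>The supremum is taken in the reals, so it dominates its members only once they are known
  to be bounded; here 1 is a bound.\<close>

lemma tv_dist_upper:
  assumes "prob_space M" "prob_space N" "A \<in> sets M"
  shows "\<bar>measure M A - measure N A\<bar> \<le> tv_dist M N"
  unfolding tv_dist_def
proof (rule cSUP_upper[OF assms(3)])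
  have "\<bar>measure M B - measure N B\<bar> \<le> 1" for B
    using prob_space.prob_le_1[OF assms(1), of B] prob_space.prob_le_1[OF assms(2), of B]
      measure_nonneg[of M B] measure_nonneg[of N B] by linarith
  then show "bdd_above ((\<lambda>B. \<bar>measure M B - measure N B\<bar>) ` sets M)"
    by (auto intro!: bdd_aboveI2)
qed

lemma prob_space_p_gauss: "\<alpha> > 0 \<Longrightarrow> prob_space (p_gauss \<alpha> \<theta>)"
  unfolding p_gauss_def by (rule prob_space_normal_density) simp

lemma measure_p_gauss_shift:
  "measure (p_gauss \<alpha> \<theta>) {..m} = measure (p_gauss \<alpha> 0) {..m - \<theta>}"
proof -
  have "emeasure (p_gauss \<alpha> \<theta>) {..m} =
      (\<integral>\<^sup>+x. ennreal (normal_density \<theta> (1 / sqrt \<alpha>) x) * indicator {..m} x \<partial>lborel)"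
    unfolding p_gauss_def by (subst emeasure_density) auto
  also have "\<dots> = (\<integral>\<^sup>+x. ennreal (normal_density \<theta> (1 / sqrt \<alpha>) (\<theta> + 1 * x)) *
      indicator {..m} (\<theta> + 1 * x) \<partial>lborel)"
    by (subst nn_integral_real_affine[where c=1 and t=\<theta>]) auto
  also have "\<dots> = (\<integral>\<^sup>+x. ennreal (normal_density 0 (1 / sqrt \<alpha>) x) * indicator {..m - \<theta>} x \<partial>lborel)"
    by (intro nn_integral_cong) (auto simp: normal_density_def indicator_def)
  also have "\<dots> = emeasure (p_gauss \<alpha> 0) {..m - \<theta>}"
    unfolding p_gauss_def by (subst emeasure_density) auto
  finally show ?thesis
    by (simp add: measure_def)
qed

text \<open>The point \<open>m\<close> is midway between the two means. By translation the gap is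
  the mass that \<open>p_gauss \<alpha> 0\<close> gives to \<open>{-m<..m}\<close>, at least the
  length \<open>\<delta> / sqrt \<alpha>\<close> times a lower bound for the density there.\<close>

lemma p_gauss_half_line_gap:
  assumes "\<alpha> > 0" "0 < \<delta>" "\<delta> \<le> 1"
  defines "m \<equiv> \<delta> / sqrt \<alpha> / 2"
  shows "3 * \<delta> / 10 \<le> measure (p_gauss \<alpha> 0) {..m} - measure (p_gauss \<alpha> (\<delta> / sqrt \<alpha>)) {..m}"
proof -
  interpret prob_space "p_gauss \<alpha> 0"
    by (rule prob_space_p_gauss[OF assms(1)])
  have m: "m > 0"
    using assms by simp
  have sets: "sets (p_gauss \<alpha> 0) = sets borel"
    by (simp add: p_gauss_def)
  have dens: "3 / 10 * sqrt \<alpha> \<le> normal_density 0 (1 / sqrt \<alpha>) x" if x: "x \<in> {-m<..m}" for x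
  proof -
    have "x\<^sup>2 \<le> m\<^sup>2"
      using x m by (intro abs_le_square_iff[THEN iffD1]) auto
    then have "\<alpha> * x\<^sup>2 \<le> \<alpha> * m\<^sup>2"
      using assms by simp
    also have "\<dots> = \<delta>\<^sup>2 / 4"
      unfolding m_def using assms by (simp add: power_divide)
    also have "\<dots> \<le> 1 / 4"
      using assms by (simp add: power_le_one)
    finally have "7 / 8 \<le> 1 + - (\<alpha> * x\<^sup>2 / 2)"
      by simp
    also have "\<dots> \<le> exp (- (\<alpha> * x\<^sup>2 / 2))"
      by (rule exp_ge_add_one_self)
    finally have e: "7 / 8 \<le> exp (- (\<alpha> * x\<^sup>2 / 2))" .
    \<comment> \<open>The bound \<open>pi < 4\<close> suffices, since
      \<open>8 \<le> (35 / 12)^2\<close>. The value 35/12 is chosen to make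
      \<open>12 / 35 * (7 / 8)\<close> equal to 3/10.\<close>
    have "sqrt (2 * pi) \<le> 35 / 12"
      using pi_less_4 by (intro real_le_lsqrt) (auto simp: power2_eq_square)
    then have s: "12 / 35 \<le> 1 / sqrt (2 * pi)"
      by (simp add: field_simps)
    have "3 / 10 * sqrt \<alpha> = sqrt \<alpha> * (12 / 35 * (7 / 8))"
      by simp
    also have "\<dots> \<le> sqrt \<alpha> * (1 / sqrt (2 * pi) * exp (- (\<alpha> * x\<^sup>2 / 2)))"
      using s e assms by (intro mult_left_mono mult_mono) auto
    also have "\<dots> = normal_density 0 (1 / sqrt \<alpha>) x"
      using assms by (simp add: normal_density_def real_sqrt_divide power_divide field_simps)
    finally show ?thesis .
  qed
  have "ennreal (3 * \<delta> / 10) = ennreal (3 / 10 * sqrt \<alpha>) * emeasure lborel {-m<..m}"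
    using assms m by (simp add: m_def flip: ennreal_mult)
  also have "\<dots> = (\<integral>\<^sup>+x. ennreal (3 / 10 * sqrt \<alpha>) * indicator {-m<..m} x \<partial>lborel)"
    by (simp add: nn_integral_cmult_indicator)
  also have "\<dots> \<le> (\<integral>\<^sup>+x. ennreal (normal_density 0 (1 / sqrt \<alpha>) x) * indicator {-m<..m} x \<partial>lborel)"
    using dens by (intro nn_integral_mono) (auto split: split_indicator intro!: ennreal_leI)
  also have "\<dots> = emeasure (p_gauss \<alpha> 0) {-m<..m}"
    unfolding p_gauss_def by (subst emeasure_density) auto
  finally have "3 * \<delta> / 10 \<le> measure (p_gauss \<alpha> 0) {-m<..m}"
    by (simp add: emeasure_eq_measure)
  also have "{-m<..m} = {..m} - {..-m}"
    by auto
  also have "measure (p_gauss \<alpha> 0) \<dots> = measure (p_gauss \<alpha> 0) {..m} - measure (p_gauss \<alpha> 0) {..-m}"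
    using m by (intro finite_measure_Diff) (auto simp: sets)
  also have "measure (p_gauss \<alpha> 0) {..-m} = measure (p_gauss \<alpha> (\<delta> / sqrt \<alpha>)) {..m}"
    unfolding measure_p_gauss_shift[of \<alpha> "\<delta> / sqrt \<alpha>"] by (simp add: m_def mult.commute)
  finally show ?thesis .
qed

subsection \<open>The lower bound\<close>

text \<open>Each \<open>u\<close> in the set defining \<open>F_psi\<close> yields its own jump
  oracle and its own real inequality, so the possibly infinite supremum need not be handled
  here.\<close>

lemma query_lower_bound:
  fixes \<alpha> \<delta> u :: real and \<psi> :: "real \<Rightarrow> real"
  assumes \<alpha>: "\<alpha> > 0"
    and psi: "\<psi> \<in> {0..} \<rightarrow> {0..}" "mono_on {0..} \<psi>" "\<psi> 0 = 0"
    and \<delta>: "0 < \<delta>" "\<delta> \<le> 1"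
    and alg: "query_algorithm R T qry out"
    and tv: "\<forall>\<theta>\<in>{0, \<delta> / sqrt \<alpha>}. \<forall>Orc. psi_oracle \<psi> (f_quad \<alpha> \<theta>) Orc \<longrightarrow>
           tv_dist (p_gauss \<alpha> \<theta>) (output_law R T qry out Orc) \<le> \<delta> / 10"
    and u: "sqrt \<alpha> * \<delta> \<le> u"
      "sqrt \<alpha> * \<delta> * \<psi> u \<le> (1 - \<psi> (sqrt \<alpha> * \<delta>)) * u"
  shows "u / (10 * sqrt \<alpha>) \<le> real T"
proof -
  define t where "t = sqrt \<alpha> * \<delta>"
  \<comment> \<open>With this \<open>v\<close> and \<open>p\<close>, the mean shift
    \<open>p * v\<close> is \<open>t\<close>. The error is \<open>u\<close> when a jump occurs, with
    probability \<open>t / v\<close>, and \<open>t\<close> when none does, with probability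
    \<open>u / v\<close>.\<close>
  define v where "v = u + t"
  define p where "p = t / v"
  define \<theta> where "\<theta> = \<delta> / sqrt \<alpha>"
  have t: "t > 0"
    using \<alpha> \<delta> by (simp add: t_def)
  then have u0: "u > 0"
    using u(1) unfolding t_def by linarith
  with t have v: "v > 0"
    by (simp add: v_def)
  have p: "0 \<le> p" "p \<le> 1" and pv: "p * v = t"
    using t u0 v by (auto simp: p_def v_def)
  have \<alpha>\<theta>: "\<alpha> * \<theta> = t"
    unfolding \<theta>_def t_def using \<alpha> real_sqrt_mult_self[of \<alpha>] by (simp add: field_simps)
  \<comment> \<open>The condition on \<open>u\<close> reads
    \<open>t * \<psi> u + u * \<psi> t \<le> u\<close>, and \<open>u \<le> v\<close>. Divided by
    \<open>v\<close>, this is the moment bound for the jump oracle.\<close>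
  have ineq: "t * \<psi> u + u * \<psi> t \<le> v"
    using u(2) t unfolding t_def[symmetric] v_def left_diff_distrib by (simp add: mult.commute)
  have "1 - p = u / v"
    using v by (simp add: p_def v_def divide_simps)
  then have "p * \<psi> \<bar>v - p * v\<bar> + (1 - p) * \<psi> \<bar>p * v\<bar> = (t * \<psi> u + u * \<psi> t) / v"
    using t u0 unfolding pv by (simp add: p_def v_def add_divide_distrib)
  also have "\<dots> \<le> 1"
    using ineq v by simp
  finally have small: "p * \<psi> \<bar>v - p * v\<bar> + (1 - p) * \<psi> \<bar>p * v\<bar> \<le> 1" .
  have jump: "psi_oracle \<psi> (f_quad \<alpha> \<theta>) (jump_oracle \<alpha> p v)"
    by (rule psi_oracle_jump[OF psi(2,1) p _ small]) (simp add: pv \<alpha>\<theta>)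
  \<comment> \<open>For \<open>p = 0\<close> the error vanishes almost surely, so the moment is
    \<open>\<psi> 0 = 0\<close>.\<close>
  have exact: "psi_oracle \<psi> (f_quad \<alpha> 0) (jump_oracle \<alpha> 0 v)"
    by (rule psi_oracle_jump[OF psi(2,1)]) (simp_all add: psi(3))
  define M0 M1 where "M0 = output_law R T qry out (jump_oracle \<alpha> 0 v)"
    and "M1 = output_law R T qry out (jump_oracle \<alpha> p v)"
  have M: "prob_space M0" "prob_space M1"
    unfolding M0_def M1_def by (intro prob_space_output_law[OF alg] jump_oracle_kernel)+
  define A where "A = {..\<delta> / sqrt \<alpha> / 2}"
  have A: "A \<in> sets (p_gauss \<alpha> \<eta>)" for \<eta>
    by (simp add: A_def p_gauss_def)
  have "\<bar>measure (p_gauss \<alpha> 0) A - measure M0 A\<bar> \<le> \<delta> / 10"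
  proof (rule order_trans[OF tv_dist_upper[OF prob_space_p_gauss[OF \<alpha>] M(1) A]])
    show "tv_dist (p_gauss \<alpha> 0) M0 \<le> \<delta> / 10"
      unfolding M0_def by (rule tv[rule_format, OF _ exact]) simp
  qed
  moreover have "\<bar>measure (p_gauss \<alpha> \<theta>) A - measure M1 A\<bar> \<le> \<delta> / 10"
  proof (rule order_trans[OF tv_dist_upper[OF prob_space_p_gauss[OF \<alpha>] M(2) A]])
    show "tv_dist (p_gauss \<alpha> \<theta>) M1 \<le> \<delta> / 10"
      unfolding M1_def by (rule tv[rule_format, OF _ jump]) (simp add: \<theta>_def)
  qed
  moreover have "3 * \<delta> / 10 \<le> measure (p_gauss \<alpha> 0) A - measure (p_gauss \<alpha> \<theta>) A"
    unfolding A_def \<theta>_def by (rule p_gauss_half_line_gap[OF \<alpha> \<delta>])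
  \<comment> \<open>Dropping the jump term leaves \<open>1 - p\<close> times the integral for the
    exact oracle, which is the required domination.\<close>
  moreover have "measure M0 A \<le> measure M1 A + real T * p"
    unfolding M0_def M1_def
    by (rule measure_output_law_le[OF alg jump_oracle_kernel jump_oracle_kernel p])
       (use p in \<open>auto simp: nn_integral_jump_oracle A_def\<close>)
  \<comment> \<open>Of the Gaussian gap \<open>3 * \<delta> / 10\<close>, each of the two total
    variation errors uses up at most \<open>\<delta> / 10\<close>.\<close>
  ultimately have "\<delta> / 10 \<le> real T * p"
    by linarith
  then have "\<delta> * v \<le> 10 * real T * t"
    using v by (simp add: p_def field_simps)
  then have "v \<le> 10 * real T * sqrt \<alpha>"
    using \<delta> by (simp add: t_def mult.commute mult.left_commute)
  then have "u \<le> 10 * real T * sqrt \<alpha>"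
    using t by (simp add: v_def)
  then show ?thesis
    using \<alpha> by (simp add: field_simps)
qed

theorem proposition4p1:
  fixes \<alpha> \<delta> :: real and \<psi> :: "real \<Rightarrow> real" and T :: nat
    and R :: "'r measure"
    and qry :: "nat \<Rightarrow> 'r \<times> (nat \<Rightarrow> real) \<Rightarrow> real"
    and out :: "'r \<times> (nat \<Rightarrow> real) \<Rightarrow> real"
  assumes "\<alpha> > 0"
    and "\<psi> \<in> {0..} \<rightarrow> {0..}" and "mono_on {0..} \<psi>" and "\<psi> 0 = 0"
    and "T \<ge> 1" and "0 < \<delta>" and "\<delta> \<le> 1"
    and "query_algorithm R T qry out"
    and "\<forall>\<theta>\<in>{0, \<delta> / sqrt \<alpha>}. \<forall>Orc. psi_oracle \<psi> (f_quad \<alpha> \<theta>) Orc \<longrightarrow>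
           tv_dist (p_gauss \<alpha> \<theta>) (output_law R T qry out Orc) \<le> \<delta> / 10"
  shows "ereal (real T) \<ge> ereal (1 / (10 * sqrt \<alpha>)) * F_psi \<psi> (sqrt \<alpha> * \<delta>)"
proof -
  define S where "S = {u. u \<ge> sqrt \<alpha> * \<delta> \<and> (1 - \<psi> (sqrt \<alpha> * \<delta>)) * u \<ge> sqrt \<alpha> * \<delta> * \<psi> u}"
  \<comment> \<open>A bound uniform in \<open>u\<close> also shows the supremum to be finite. If
    \<open>S\<close> is empty, \<open>F_psi\<close> is 0 and the right-hand side is
    nonnegative.\<close>
  have "F_psi \<psi> (sqrt \<alpha> * \<delta>) \<le> ereal (10 * sqrt \<alpha> * real T)"
  proof (cases "S = {}")
    case True
    then show ?thesis
      using assms(1) by (simp add: F_psi_def S_def[symmetric])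
  next
    case False
    have "u \<le> 10 * sqrt \<alpha> * real T" if "u \<in> S" for u
      using query_lower_bound[OF assms(1-4,6-9), of u] that assms(1)
      by (simp add: S_def field_simps)
    then show ?thesis
      using False by (simp add: F_psi_def S_def[symmetric] SUP_least)
  qed
  then have "ereal (1 / (10 * sqrt \<alpha>)) * F_psi \<psi> (sqrt \<alpha> * \<delta>)
      \<le> ereal (1 / (10 * sqrt \<alpha>)) * ereal (10 * sqrt \<alpha> * real T)"
    using assms(1) by (intro ereal_mult_left_mono) auto
  also have "\<dots> = ereal (real T)"
    using assms(1) by simp
  finally show ?thesis .
qed

end
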